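(* The Kakutani-Fibonacci sequence of points $(\xi_{1,1}^n)_{n\ge1}$ coincides with the orbit $(T^n(0))_{n\ge0}$ of the origin under the Kakutani-Fibonacci transformation $T$; that is, $\xi_{1,1}^{n}=T^{n-1}(0)$ for every $n\ge1$.
   Context: $[a,b[$ denotes the half-open interval $\{x:a\le x<b\}$. Let $\alpha=\frac{\sqrt5-1}{2}$, so $\alpha+\alpha^2=1$. Kakutani-Fibonacci transformation: $T:[0,1[\to[0,1[$ is defined piecewise by: $T(x)=x+\alpha$ for $x\in I_1=[0,\alpha^2[$; and, for every $k\ge1$, $T(x)=x+\alpha^{2k}-\sum_{j=0}^{k-1}\alpha^{2j+1}$ for $x\in I_{2k}=\big[\sum_{j=0}^{k-1}\alpha^{2j+1},\sum_{j=0}^{k}\alpha^{2j+1}\big[$, and $T(x)=x+\alpha^{2k+1}-\sum_{j=0}^{k-1}\alpha^{2(j+1)}$ for $x\in I_{2k+1}=\big[\sum_{j=0}^{k-1}\alpha^{2(j+1)},\sum_{j=0}^{k}\alpha^{2(j+1)}\big[$. The intervals $I_k$, $k\ge1$, partition $[0,1[$. $T^0(x)=x$ and $T^n=T\circ T^{n-1}$. Kakutani-Fibonacci sequence of points: let $l_1=s_1=1$ and, for $n\ge2$, $l_n=l_{n-1}+s_{n-1}$, $s_n=l_{n-1}$, and put $t_n=l_n+s_n$ (these are the numbers of intervals of length $\alpha^n$, of length $\alpha^{n+1}$, and the total number of intervals of the $n$-th partition obtained from $\{[0,1[\}$ by successively splitting all intervals of maximal length into two parts proportional to $\alpha$ and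 $\alpha^2$, left to right). Define finite ordered lists $\Lambda^n$ of length $t_n$ by $\Lambda^1=(0,\alpha)$ and, if $\Lambda^n=(\xi_1,\dots,\xi_{t_n})$, then $\Lambda^{n+1}=(\xi_1,\dots,\xi_{t_n},\ \xi_1+\alpha^{n+1},\dots,\xi_{l_n}+\alpha^{n+1})$. Each list is an initial segment of the next one, and $(\xi_{1,1}^n)_{n\ge1}$ is the infinite sequence having all the $\Lambda^n$ as initial segments. *)

theory Defs
  imports Complex_Main
begin

definition alpha :: real (\<open>\<alpha>\<close>) where
  "\<alpha> = (sqrt 5 - 1) / 2"

lemma alpha_add_power2: "\<alpha> + \<alpha>\<^sup>2 = 1"
  by (simp add: alpha_def power2_eq_square field_simps)

lemma alpha_pos: "0 < \<alpha>"
  by (simp add: alpha_def)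

lemma alpha_less_1: "\<alpha> < 1"
  using alpha_add_power2 alpha_pos by (smt (verit) zero_less_power)


section \<open>The Kakutani-Fibonacci transformation\<close>

text \<open>
  The intervals are indexed by \<open>i \<ge> 1\<close>. Both \<open>i = 2 * k\<close> and \<open>i = 2 * k + 1\<close> with \<open>k \<ge> 1\<close>
  have \<open>i div 2 = k\<close>. The values at \<open>i = 0\<close> are never used.
\<close>

definition kf_interval :: "nat \<Rightarrow> real set" where
  "kf_interval i =
    (let k = i div 2 in
     if i = 1 then {0 ..< \<alpha>^2}
     else if even i then {(\<Sum>j<k. \<alpha>^(2*j+1)) ..< (\<Sum>j\<le>k. \<alpha>^(2*j+1))}
     else {(\<Sum>j<k. \<alpha>^(2*(j+1))) ..< (\<Sum>j\<le>k. \<alpha>^(2*(j+1)))})"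

definition kf_shift :: "nat \<Rightarrow> real" where
  "kf_shift i =
    (let k = i div 2 in
     if i = 1 then \<alpha>
     else if even i then \<alpha>^(2*k) - (\<Sum>j<k. \<alpha>^(2*j+1))
     else \<alpha>^(2*k+1) - (\<Sum>j<k. \<alpha>^(2*(j+1))))"

text \<open>
  Only the values on \<open>{0..<1}\<close> are meaningful; there the index is unique
  (\<open>kf_interval_ex1\<close> below), and \<open>kf_T\<close> maps \<open>{0..<1}\<close> into itself (\<open>kf_T_range\<close>).
\<close>

definition kf_T :: "real \<Rightarrow> real" where
  "kf_T x = x + kf_shift (THE i. 1 \<le> i \<and> x \<in> kf_interval i)"


section \<open>The Kakutani-Fibonacci sequence of points\<close>

text \<open>All indices start at 1; the equations for index 0 are dummies.\<close>

fun kf_l :: "nat \<Rightarrow> nat" and kf_s :: "nat \<Rightarrow> nat" where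
  "kf_l 0 = 0"
| "kf_l (Suc 0) = 1"
| "kf_l (Suc (Suc n)) = kf_l (Suc n) + kf_s (Suc n)"
| "kf_s 0 = 0"
| "kf_s (Suc 0) = 1"
| "kf_s (Suc (Suc n)) = kf_l (Suc n)"

definition kf_t :: "nat \<Rightarrow> nat" where
  "kf_t n = kf_l n + kf_s n"

fun kf_list :: "nat \<Rightarrow> real list" where
  "kf_list 0 = []"
| "kf_list (Suc 0) = [0, \<alpha>]"
| "kf_list (Suc (Suc n)) =
     kf_list (Suc n) @ map (\<lambda>\<xi>. \<xi> + \<alpha>^(Suc (Suc n))) (take (kf_l (Suc n)) (kf_list (Suc n)))"

text \<open>
  Since \<open>kf_list n\<close> has at least \<open>n\<close> entries, its \<open>n\<close>-th entry exists; as each list is an initial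
  segment of the next one, this is the \<open>n\<close>-th term of the sequence having all the lists as initial
  segments (\<open>kf_point_characterization\<close> below).
\<close>

definition kf_point :: "nat \<Rightarrow> real" where
  "kf_point n = kf_list n ! (n - 1)"


section \<open>Well-definedness\<close>

lemma sum_alpha_odd: "(\<Sum>j<k. \<alpha>^(2*j+1)) = 1 - \<alpha>^(2*k)"
proof (induction k)
  case (Suc k)
  have "\<alpha>^(2*k) * (\<alpha> + \<alpha>\<^sup>2) = \<alpha>^(2*k)"
    by (simp add: alpha_add_power2)
  with Suc show ?case
    by (simp add: algebra_simps power2_eq_square)
qed simp

lemma sum_alpha_even: "(\<Sum>j<k. \<alpha>^(2*(j+1))) = \<alpha> - \<alpha>^(2*k+1)"
proof -
  have "(\<Sum>j<k. \<alpha>^(2*(j+1))) = \<alpha> * (\<Sum>j<k. \<alpha>^(2*j+1))"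
    by (simp add: sum_distrib_left)
  then show ?thesis
    by (simp only: sum_alpha_odd) (simp add: algebra_simps)
qed

lemma kf_interval_one: "kf_interval 1 = {0 ..< \<alpha>^2}"
  by (simp add: kf_interval_def)

lemma kf_interval_even:
  assumes "1 \<le> k"
  shows "kf_interval (2*k) = {1 - \<alpha>^(2*k) ..< 1 - \<alpha>^(2*k+2)}"
proof -
  have "(2*k) div 2 = k" "2*k \<noteq> 1" "even (2*k)" by presburger+
  then show ?thesis
    unfolding kf_interval_def Let_def lessThan_Suc_atMost [symmetric] sum_alpha_odd
    by (simp only: if_False if_True mult_Suc_right add.commute)
qed

lemma kf_interval_odd: "kf_interval (2*k+1) = {\<alpha> - \<alpha>^(2*k+1) ..< \<alpha> - \<alpha>^(2*k+3)}"
proof (cases "k = 0")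
  case True
  have "\<alpha> - \<alpha>^3 = \<alpha>^2"
  proof -
    have "\<alpha> - \<alpha>^3 = \<alpha> * (1 - \<alpha>\<^sup>2)" by (simp add: algebra_simps power2_eq_square power3_eq_cube)
    also have "1 - \<alpha>\<^sup>2 = \<alpha>" using alpha_add_power2 by simp
    finally show ?thesis by (simp add: power2_eq_square)
  qed
  with True show ?thesis by (simp add: kf_interval_def)
next
  case False
  then have "(2*k+1) div 2 = k" "2*k+1 \<noteq> 1" "odd (2*k+1)" by presburger+
  then show ?thesis
    unfolding kf_interval_def Let_def lessThan_Suc_atMost [symmetric] sum_alpha_even
    by (simp add: numeral_3_eq_3)
qed

lemma alpha_power_bracket:
  assumes "0 < y" "y \<le> 1"
  shows "\<exists>!k. \<alpha>^(2*k+2) < y \<and> y \<le> \<alpha>^(2*k)"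
proof -
  have a: "0 < \<alpha>\<^sup>2" "\<alpha>\<^sup>2 < 1"
    using alpha_pos alpha_less_1 by (simp_all add: power_less_one_iff)
  have "\<exists>n. (\<alpha>\<^sup>2)^n < y"
    using real_arch_pow_inv [OF assms(1) a(2)] .
  define n where "n = (LEAST n. (\<alpha>\<^sup>2)^n < y)"
  have n: "(\<alpha>\<^sup>2)^n < y"
    unfolding n_def by (rule LeastI_ex) fact
  have "n \<noteq> 0" using n assms(2) by (cases n) auto
  then obtain k where k: "n = Suc k" by (cases n) auto
  have "\<not> (\<alpha>\<^sup>2)^k < y"
    using not_less_Least [of k "\<lambda>n. (\<alpha>\<^sup>2)^n < y"] k n_def by auto
  moreover have "(\<alpha>\<^sup>2)^n = \<alpha>^(2*k+2)" "(\<alpha>\<^sup>2)^k = \<alpha>^(2*k)"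
    unfolding k power_mult [symmetric] by simp_all
  ultimately have ex: "\<alpha>^(2*k+2) < y \<and> y \<le> \<alpha>^(2*k)"
    using n by simp
  have anti: "\<alpha>^b \<le> \<alpha>^a" if "a \<le> b" for a b :: nat
    using that alpha_pos alpha_less_1 by (intro power_decreasing) auto
  show ?thesis
  proof (rule ex1I [of _ k])
    fix m assume m: "\<alpha>^(2*m+2) < y \<and> y \<le> \<alpha>^(2*m)"
    have "\<not> m < k" using m ex anti [of "2*m+2" "2*k"] by auto
    moreover have "\<not> k < m" using m ex anti [of "2*k+2" "2*m"] by auto
    ultimately show "m = k" by simp
  qed (use ex in simp)
qed

lemma kf_interval_ex1:
  assumes "x \<in> {0..<1}"
  shows "\<exists>!i. 1 \<le> i \<and> x \<in> kf_interval i"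
proof (cases "x < \<alpha>")
  case True
  have odd_iff: "x \<in> kf_interval (2*k+1) \<longleftrightarrow> \<alpha>^(2*k+2) < (\<alpha> - x) / \<alpha> \<and> (\<alpha> - x) / \<alpha> \<le> \<alpha>^(2*k)" for k
    unfolding kf_interval_odd using alpha_pos
    by (auto simp add: field_simps power_add numeral_3_eq_3)
  have "0 < (\<alpha> - x) / \<alpha>" "(\<alpha> - x) / \<alpha> \<le> 1"
    using True assms alpha_pos by (auto simp: field_simps)
  from alpha_power_bracket [OF this] have ex1: "\<exists>!k. x \<in> kf_interval (2*k+1)"
    unfolding odd_iff .
  have not_even: "x \<notin> kf_interval (2*k)" if "1 \<le> k" for k
  proof -
    have "\<alpha>^(2*k) \<le> \<alpha>^2"
      using that alpha_pos alpha_less_1 by (intro power_decreasing) auto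
    with True alpha_add_power2 show ?thesis
      by (simp add: kf_interval_even [OF that])
  qed
  from ex1 obtain k where k: "x \<in> kf_interval (2*k+1)" by blast
  show ?thesis
  proof (rule ex1I [of _ "2*k+1"])
    fix i assume i: "1 \<le> i \<and> x \<in> kf_interval i"
    show "i = 2*k+1"
    proof (cases "even i")
      case True
      then obtain m where "i = 2*m" by blast
      with i not_even [of m] show ?thesis by auto
    next
      case False
      then obtain m where "i = 2*m+1" by (auto elim: oddE)
      with i ex1 k show ?thesis by auto
    qed
  qed (use k in simp)
next
  case False
  then have x: "\<alpha> \<le> x" by simp
  have even_iff: "x \<in> kf_interval (2*k) \<longleftrightarrow> \<alpha>^(2*k+2) < 1 - x \<and> 1 - x \<le> \<alpha>^(2*k)" if "1 \<le> k" for k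
    by (auto simp add: kf_interval_even [OF that])
  have "0 < 1 - x" "1 - x \<le> 1" using assms by auto
  note ex1 = alpha_power_bracket [OF this]
  then obtain k where k: "\<alpha>^(2*k+2) < 1 - x \<and> 1 - x \<le> \<alpha>^(2*k)" by blast
  have k1: "1 \<le> k"
  proof (rule ccontr)
    assume "\<not> 1 \<le> k"
    then have "\<alpha>^2 < 1 - x" using k by (simp add: not_le power2_eq_square)
    with x alpha_add_power2 show False by simp
  qed
  have not_odd: "x \<notin> kf_interval (2*k+1)" for k
  proof -
    have "0 < \<alpha>^(2*k+3)" using alpha_pos by simp
    with x show ?thesis unfolding kf_interval_odd by simp
  qed
  show ?thesis
  proof (rule ex1I [of _ "2*k"])
    fix i assume i: "1 \<le> i \<and> x \<in> kf_interval i"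
    show "i = 2*k"
    proof (cases "even i")
      case True
      then obtain m where m: "i = 2*m" by blast
      with i have "1 \<le> m" by simp
      then have "\<alpha>^(2*m+2) < 1 - x \<and> 1 - x \<le> \<alpha>^(2*m)"
        using i even_iff [of m] m by simp
      with ex1 k m show ?thesis by auto
    next
      case False
      then obtain m where "i = 2*m+1" by (auto elim: oddE)
      with i not_odd [of m] show ?thesis by auto
    qed
  qed (use k k1 even_iff [OF k1] in simp)
qed

lemma kf_interval_subset: "1 \<le> i \<Longrightarrow> kf_interval i \<subseteq> {0..<1}"
proof (cases "even i")
  case True
  assume "1 \<le> i"
  obtain k where k: "i = 2*k" using True by blast
  with \<open>1 \<le> i\<close> have "1 \<le> k" by simp
  have "\<alpha>^(2*k) \<le> 1" "0 < \<alpha>^(2*k+2)"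
    using alpha_pos alpha_less_1 by (auto intro: power_le_one)
  then show ?thesis
    unfolding k kf_interval_even [OF \<open>1 \<le> k\<close>] by auto
next
  case False
  then obtain k where k: "i = 2*k+1" by (auto elim: oddE)
  have "\<alpha>^(2*k+1) \<le> \<alpha>^1"
    using alpha_pos alpha_less_1 by (intro power_decreasing) auto
  moreover have "0 < \<alpha>^(2*k+3)" using alpha_pos by simp
  ultimately show ?thesis
    unfolding k kf_interval_odd using alpha_less_1 by auto
qed

lemma kf_T_eq:
  assumes "1 \<le> i" "x \<in> kf_interval i"
  shows "kf_T x = x + kf_shift i"
proof -
  have "x \<in> {0..<1}" using kf_interval_subset assms by blast
  then have "(THE i. 1 \<le> i \<and> x \<in> kf_interval i) = i"
    using assms kf_interval_ex1 by (intro the1_equality) auto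
  then show ?thesis by (simp add: kf_T_def)
qed

lemma kf_T_one: "x \<in> kf_interval 1 \<Longrightarrow> kf_T x = x + \<alpha>"
  using kf_T_eq [of 1 x] by (simp add: kf_shift_def)

lemma kf_T_even:
  "1 \<le> k \<Longrightarrow> x \<in> kf_interval (2*k) \<Longrightarrow> kf_T x = x + \<alpha>^(2*k) - (\<Sum>j<k. \<alpha>^(2*j+1))"
  using kf_T_eq [of "2*k" x] by (auto simp: kf_shift_def Let_def)

lemma kf_T_odd:
  "1 \<le> k \<Longrightarrow> x \<in> kf_interval (2*k+1) \<Longrightarrow> kf_T x = x + \<alpha>^(2*k+1) - (\<Sum>j<k. \<alpha>^(2*(j+1)))"
  using kf_T_eq [of "2*k+1" x] by (auto simp: kf_shift_def Let_def)

lemma kf_T_range: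
  assumes "x \<in> {0..<1}"
  shows "kf_T x \<in> {0..<1}"
proof -
  obtain i where i: "1 \<le> i" "x \<in> kf_interval i"
    using kf_interval_ex1 [OF assms] by blast
  have pw: "\<alpha>^(n+2) = \<alpha>^n - \<alpha>^(n+1)" for n
  proof -
    have "\<alpha>^n * (\<alpha> + \<alpha>\<^sup>2) = \<alpha>^n" by (simp add: alpha_add_power2)
    then show ?thesis by (simp add: algebra_simps power2_eq_square)
  qed
  have pos: "0 < \<alpha>^n" for n using alpha_pos by simp
  have le: "\<alpha>^n \<le> \<alpha>^2" if "2 \<le> n" for n
    using that alpha_pos alpha_less_1 by (intro power_decreasing) auto
  have le1: "\<alpha>^(n+1) \<le> \<alpha>" for n
    using alpha_pos alpha_less_1 power_decreasing [of 1 "n+1" \<alpha>] by simp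
  show ?thesis
  proof (cases "even i")
    case True
    then obtain k where k: "i = 2*k" by blast
    with i have k1: "1 \<le> k" by simp
    have T: "kf_T x = x + \<alpha>^(2*k) - (1 - \<alpha>^(2*k))"
      using kf_T_even [OF k1] i k by (simp only: sum_alpha_odd)
    have "1 - \<alpha>^(2*k) \<le> x" "x < 1 - \<alpha>^(2*k+2)"
      using i unfolding k kf_interval_even [OF k1] by auto
    moreover have "\<alpha>^(2*k) \<le> \<alpha>^2" using k1 by (intro le) simp
    ultimately have "0 \<le> kf_T x" "kf_T x < 1"
      using pw [of "2*k"] pos [of "2*k"] le1 [of "2*k"] T alpha_add_power2 by linarith+
    then show ?thesis by simp
  next
    case False
    then obtain k where k: "i = 2*k+1" by (auto elim: oddE)
    show ?thesis
    proof (cases "k = 0")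
      case True
      with i k have "x \<in> kf_interval 1" by simp
      then show ?thesis
        using kf_T_one [of x] alpha_add_power2 alpha_pos unfolding kf_interval_one by auto
    next
      case False
      then have k1: "1 \<le> k" by simp
      have T: "kf_T x = x + \<alpha>^(2*k+1) - (\<alpha> - \<alpha>^(2*k+1))"
        using kf_T_odd [OF k1] i k by (simp only: sum_alpha_even)
      have "\<alpha> - \<alpha>^(2*k+1) \<le> x" "x < \<alpha> - \<alpha>^(2*k+3)"
        using i unfolding k kf_interval_odd by auto
      moreover have "\<alpha>^(2*k+2) \<le> \<alpha>^2" using k1 by (intro le) simp
      moreover have "\<alpha>^(2*k+3) = \<alpha>^(2*k+1) - \<alpha>^(2*k+2)"
        using pw [of "2*k+1"] by (simp add: numeral_3_eq_3)
      ultimately have "0 \<le> kf_T x" "kf_T x < 1"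
        using pos [of "2*k+1"] le1 [of "2*k"] T alpha_add_power2 by linarith+
      then show ?thesis by simp
    qed
  qed
qed

lemma length_kf_list: "length (kf_list n) = kf_t n"
  by (induction n rule: kf_list.induct) (auto simp: kf_t_def)

lemma kf_l_pos: "1 \<le> n \<Longrightarrow> 1 \<le> kf_l n"
proof (induction n rule: dec_induct)
  case (step n) then show ?case by (cases n) auto
qed simp

lemma le_kf_t: "n \<le> kf_t n"
proof (induction n)
  case (Suc n)
  then show ?case using kf_l_pos [of n] by (cases n) (auto simp: kf_t_def)
qed simp

lemma kf_list_prefix:
  assumes "m \<le> n"
  shows "\<exists>ys. kf_list n = kf_list m @ ys"
  using assms
proof (induction n rule: dec_induct)
  case (step n) then show ?case by (cases n) auto
qed simp

lemma kf_list_eq_kf_point: "kf_list m = map kf_point [1..<Suc (kf_t m)]"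
proof (rule nth_equalityI)
  fix i assume i: "i < length (kf_list m)"
  have i': "i < length (kf_list (Suc i))"
    using le_kf_t [of "Suc i"] by (simp add: length_kf_list)
  have "kf_list (Suc i) ! i = kf_list m ! i"
    using kf_list_prefix [of m "Suc i"] kf_list_prefix [of "Suc i" m] i i'
    by (metis nat_le_linear nth_append)
  then show "kf_list m ! i = map kf_point [1..<Suc (kf_t m)] ! i"
    using i by (simp add: length_kf_list kf_point_def del: upt_Suc)
qed (simp add: length_kf_list)

lemma kf_point_characterization:
  "(\<forall>m\<ge>1. kf_list m = map \<zeta> [1..<Suc (kf_t m)]) \<longleftrightarrow> (\<forall>n\<ge>1. \<zeta> n = kf_point n)"
proof
  assume *: "\<forall>m\<ge>1. kf_list m = map \<zeta> [1..<Suc (kf_t m)]"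
  show "\<forall>n\<ge>1. \<zeta> n = kf_point n"
  proof (intro allI impI)
    fix n :: nat assume n: "1 \<le> n"
    have "map \<zeta> [1..<Suc (kf_t n)] = map kf_point [1..<Suc (kf_t n)]"
      using * n kf_list_eq_kf_point [of n] by metis
    moreover have "n \<in> set [1..<Suc (kf_t n)]" using n le_kf_t [of n] by (simp del: upt_Suc)
    ultimately show "\<zeta> n = kf_point n" by (meson map_eq_conv)
  qed
next
  assume *: "\<forall>n\<ge>1. \<zeta> n = kf_point n"
  show "\<forall>m\<ge>1. kf_list m = map \<zeta> [1..<Suc (kf_t m)]"
    using * unfolding kf_list_eq_kf_point by (auto simp del: upt_Suc)
qed

end

theory Submission
  imports Defs
begin

text \<open>
  The first \<open>kf_t n\<close> points are the left endpoints of the intervals of the \<open>n\<close>-th partition, those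
  of the \<open>kf_l n\<close> long intervals coming first. The last long interval starts exactly where
  \<open>kf_interval n\<close> starts, and the last short one where \<open>kf_interval (Suc n)\<close> starts; every other
  interval of the partition lies inside a single \<open>kf_interval j\<close>, where \<open>kf_T\<close> is a translation.
  Hence the second part of the next list, a translated copy of the beginning of the list, is
  again an orbit segment.
\<close>

lemma alpha_power_Suc_Suc: "\<alpha>^Suc (Suc n) = \<alpha>^n - \<alpha>^Suc n"
proof -
  have "\<alpha>^n * (\<alpha> + \<alpha>\<^sup>2) = \<alpha>^n"
    by (simp add: alpha_add_power2)
  then show ?thesis
    by (simp add: algebra_simps power2_eq_square)
qed

lemma alpha_power_Suc_less: "\<alpha>^Suc n < \<alpha>^n"
  using alpha_pos alpha_less_1 by simp

lemma kf_l_Suc: "1 \<le> n \<Longrightarrow> kf_l (Suc n) = kf_t n"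
  by (cases n) (simp_all add: kf_t_def)

lemma kf_t_Suc: "1 \<le> n \<Longrightarrow> kf_t (Suc n) = kf_t n + kf_l n"
  by (cases n) (simp_all add: kf_t_def)

lemma kf_list_nth: "i < kf_t n \<Longrightarrow> kf_list n ! i = kf_point (Suc i)"
  by (simp add: kf_list_eq_kf_point del: upt_Suc)

text \<open>The list recursion read entrywise; \<open>Suc i\<close> appears because lists are
  indexed from 0 and points from 1.\<close>

lemma kf_point_translate:
  assumes "1 \<le> n" "i < kf_l n"
  shows "kf_point (Suc (kf_t n + i)) = kf_point (Suc i) + \<alpha>^Suc n"
proof -
  have i: "i < kf_t n"
    using assms by (simp add: kf_t_def)
  have "kf_list (Suc n) = kf_list n @ map (\<lambda>\<xi>. \<xi> + \<alpha>^Suc n) (take (kf_l n) (kf_list n))"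
    using assms by (cases n) simp_all
  then have "kf_list (Suc n) ! (kf_t n + i) = kf_list n ! i + \<alpha>^Suc n"
    using assms i by (simp add: nth_append length_kf_list)
  then show ?thesis
    using assms i by (simp add: kf_list_nth kf_t_Suc)
qed

lemma kf_point_one: "kf_point 1 = 0"
  by (simp add: kf_point_def)

text \<open>Since \<open>kf_l (Suc (Suc n)) = kf_t n + kf_l n\<close>, this point is the last one in
  the translated copy that forms the end of \<open>kf_list (Suc n)\<close>. The step of two in the
  index is why the closed forms below split by parity.\<close>

lemma kf_point_kf_l_Suc_Suc:
  assumes "1 \<le> n"
  shows "kf_point (kf_l (Suc (Suc n))) = kf_point (kf_l n) + \<alpha>^Suc n"
proof -
  have "kf_l (Suc (Suc n)) = kf_t n + kf_l n"
    using assms kf_l_Suc [of "Suc n"] kf_t_Suc [of n] by simp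
  moreover have "1 \<le> kf_l n"
    using assms by (rule kf_l_pos)
  ultimately show ?thesis
    using kf_point_translate [OF assms, of "kf_l n - 1"] by simp
qed

lemma kf_point_kf_l_odd: "kf_point (kf_l (2*k+1)) = \<alpha> - \<alpha>^(2*k+1)"
proof (induction k)
  case (Suc k)
  then show ?case
    using kf_point_kf_l_Suc_Suc [of "2*k+1"] alpha_power_Suc_Suc [of "2*k+1"] by simp
qed (simp add: kf_point_def)

lemma kf_point_kf_l_even:
  assumes "1 \<le> k"
  shows "kf_point (kf_l (2*k)) = 1 - \<alpha>^(2*k)"
  using assms
proof (induction k rule: dec_induct)
  case base
  have "kf_l 2 = 2" "kf_list 2 = [0, \<alpha>, \<alpha>\<^sup>2]"
    by (simp_all add: numeral_2_eq_2)
  then show ?case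
    using alpha_add_power2 by (simp add: kf_point_def)
next
  case (step k)
  then show ?case
    using kf_point_kf_l_Suc_Suc [of "2*k"] alpha_power_Suc_Suc [of "2*k"] by simp
qed

text \<open>Both parities in one form: the last long interval of the \<open>n\<close>-th partition
  has length \<alpha>^n, and its left child under the next splitting is
  \<open>kf_interval n\<close>.\<close>

lemma kf_interval_eq_kf_point:
  assumes "1 \<le> n"
  shows "kf_interval n = {kf_point (kf_l n) ..< kf_point (kf_l n) + \<alpha>^Suc n}"
proof (cases "even n")
  case True
  then obtain k where k: "n = 2*k" by blast
  with assms have "1 \<le> k" by simp
  moreover have "1 - \<alpha>^(2*k+2) = 1 - \<alpha>^(2*k) + \<alpha>^Suc (2*k)"
    using alpha_power_Suc_Suc [of "2*k"] by simp
  ultimately show ?thesis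
    unfolding k by (simp only: kf_interval_even kf_point_kf_l_even)
next
  case False
  then obtain k where k: "n = 2*k+1" by (auto elim: oddE)
  have "\<alpha> - \<alpha>^(2*k+3) = \<alpha> - \<alpha>^(2*k+1) + \<alpha>^Suc (2*k+1)"
    using alpha_power_Suc_Suc [of "2*k+1"] by (simp add: numeral_3_eq_3)
  then show ?thesis
    unfolding k by (simp only: kf_interval_odd kf_point_kf_l_odd)
qed

lemma kf_T_kf_point_kf_l:
  assumes "1 \<le> n"
  shows "kf_T (kf_point (kf_l n)) = \<alpha>^n"
proof -
  let ?y = "kf_point (kf_l n)"
  have y: "?y \<in> kf_interval n"
    unfolding kf_interval_eq_kf_point [OF assms] using alpha_pos by simp
  show ?thesis
  proof (cases "even n")
    case True
    then obtain k where k: "n = 2*k" by blast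
    with assms have "1 \<le> k" by simp
    then show ?thesis
      using kf_T_even [of k ?y] kf_point_kf_l_even [of k] y k unfolding sum_alpha_odd by simp
  next
    case False
    then obtain k where k: "n = 2*k+1" by (auto elim: oddE)
    show ?thesis
    proof (cases "k = 0")
      case True
      then show ?thesis
        using kf_T_one [of ?y] kf_point_kf_l_odd [of k] y k by simp
    next
      case False
      then show ?thesis
        using kf_T_odd [of k ?y] kf_point_kf_l_odd [of k] y k unfolding sum_alpha_even by simp
    qed
  qed
qed

text \<open>The strict bounds leave out the last long and the last short interval, each a union of
  infinitely many \<open>kf_interval j\<close>.\<close>

lemma partition_refines_kf_interval:
  assumes "1 \<le> n"
  shows "(\<forall>i. Suc i < kf_l n \<longrightarrow>
             (\<exists>j\<ge>1. {kf_point (Suc i) ..< kf_point (Suc i) + \<alpha>^n} \<subseteq> kf_interval j)) \<and>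
         (\<forall>i\<ge>kf_l n. Suc i < kf_t n \<longrightarrow>
             (\<exists>j\<ge>1. {kf_point (Suc i) ..< kf_point (Suc i) + \<alpha>^Suc n} \<subseteq> kf_interval j))"
  using assms
proof (induction n rule: dec_induct)
  case base
  then show ?case by (simp add: kf_t_def)
next
  case (step n)
  note long = step.IH [THEN conjunct1, rule_format]
  note short = step.IH [THEN conjunct2, rule_format]
  have l: "kf_l (Suc n) = kf_t n" and t: "kf_t (Suc n) = kf_t n + kf_l n"
    using step.hyps by (simp_all add: kf_l_Suc kf_t_Suc)
  have "\<exists>j\<ge>1. {kf_point (Suc i) ..< kf_point (Suc i) + \<alpha>^Suc n} \<subseteq> kf_interval j"
    if i: "Suc i < kf_t n" for i
  proof -
    consider "Suc i < kf_l n" | "Suc i = kf_l n" | "kf_l n \<le> i" by linarith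
    then show ?thesis
    proof cases
      case 1
      then obtain j where "j \<ge> 1" "{kf_point (Suc i) ..< kf_point (Suc i) + \<alpha>^n} \<subseteq> kf_interval j"
        using long by blast
      moreover have "{kf_point (Suc i) ..< kf_point (Suc i) + \<alpha>^Suc n}
          \<subseteq> {kf_point (Suc i) ..< kf_point (Suc i) + \<alpha>^n}"
        using alpha_power_Suc_less [of n] by (simp del: power_Suc)
      ultimately show ?thesis by blast
    next
      \<comment> \<open>The last long interval is split now, and its left child is all of
        \<open>kf_interval n\<close>.\<close>
      case 2
      then show ?thesis
        using kf_interval_eq_kf_point [OF step.hyps(1)] step.hyps(1) by auto
    next
      \<comment> \<open>The short intervals of the old partition are not split and become long in
        the new one.\<close>
      case 3
      then show ?thesis using short i by blast
    qed
  qed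
  moreover have "\<exists>j\<ge>1. {kf_point (Suc i) ..< kf_point (Suc i) + \<alpha>^Suc (Suc n)} \<subseteq> kf_interval j"
    if i: "kf_t n \<le> i" "Suc i < kf_t n + kf_l n" for i
  proof -
    define m where "m = i - kf_t n"
    have m: "i = kf_t n + m" "Suc m < kf_l n"
      using i by (auto simp: m_def)
    obtain j where "j \<ge> 1" "{kf_point (Suc m) ..< kf_point (Suc m) + \<alpha>^n} \<subseteq> kf_interval j"
      using long m(2) by blast
    moreover have "kf_point (Suc i) = kf_point (Suc m) + \<alpha>^Suc n"
      using kf_point_translate [OF step.hyps(1), of m] m by simp
    \<comment> \<open>A new short interval is the right child of an old long one, as \<alpha>^(n+1)
      + \<alpha>^(n+2) = \<alpha>^n.\<close>
    then have "{kf_point (Suc i) ..< kf_point (Suc i) + \<alpha>^Suc (Suc n)}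
        \<subseteq> {kf_point (Suc m) ..< kf_point (Suc m) + \<alpha>^n}"
      unfolding alpha_power_Suc_Suc using alpha_pos by simp
    ultimately show ?thesis by blast
  qed
  ultimately show ?case
    unfolding l t by blast
qed

lemma kf_T_add:
  assumes "1 \<le> j" "x \<in> kf_interval j" "x + d \<in> kf_interval j"
  shows "kf_T (x + d) = kf_T x + d"
  using kf_T_eq [OF assms(1,2)] kf_T_eq [OF assms(1,3)] by simp

lemma kf_T_kf_point:
  assumes "1 \<le> n" "Suc i < kf_t n"
  shows "kf_T (kf_point (Suc i)) = kf_point (Suc (Suc i))"
  using assms
proof (induction n arbitrary: i rule: dec_induct)
  case base
  then have "i = 0" by (simp add: kf_t_def)
  then show ?case
    using kf_T_kf_point_kf_l [of 1] by (simp add: kf_point_def)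
next
  case (step n)
  have l: "1 \<le> kf_l n"
    using kf_l_pos step.hyps by simp
  \<comment> \<open>The point lies in the old list before its end, at its end, or in the copy before
    its end.\<close>
  consider "Suc i < kf_t n" | "Suc i = kf_t n" | m where "i = kf_t n + m" "Suc m < kf_l n"
  proof -
    have "Suc i < kf_t n + kf_l n"
      using step.prems kf_t_Suc step.hyps by simp
    then show thesis
      using that(1,2) that(3) [of "i - kf_t n"] by linarith
  qed
  then show ?case
  proof cases
    case 1
    then show ?thesis by (rule step.IH)
  next
    case 2
    \<comment> \<open>As \<open>kf_t n = kf_l (Suc n)\<close>, the last old point is the start of
      \<open>kf_interval (Suc n)\<close>. It is sent to \<alpha>^(n+1), which is the translate of 0
      and so the first point of the copy.\<close>
    then show ?thesis
      using kf_T_kf_point_kf_l [of "Suc n"] kf_point_translate [of n 0] kf_point_one step.hyps l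
      by (simp add: kf_l_Suc)
  next
    case 3
    let ?x = "kf_point (Suc m)"
    obtain j where j: "1 \<le> j" "{?x ..< ?x + \<alpha>^n} \<subseteq> kf_interval j"
      using partition_refines_kf_interval [OF step.hyps(1)] 3 by blast
    \<comment> \<open>The translate of \<open>?x\<close> is still in the same long interval, so
      \<open>kf_T\<close> moves both by the same amount.\<close>
    have "?x \<in> {?x ..< ?x + \<alpha>^n}" "?x + \<alpha>^Suc n \<in> {?x ..< ?x + \<alpha>^n}"
      using alpha_power_Suc_less [of n] zero_less_power [OF alpha_pos, of n]
        zero_less_power [OF alpha_pos, of "Suc n"] by (simp_all del: power_Suc zero_less_power)
    then have "kf_T (?x + \<alpha>^Suc n) = kf_T ?x + \<alpha>^Suc n"
      using kf_T_add j by blast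
    moreover have "kf_T ?x = kf_point (Suc (Suc m))"
      using step.IH [of m] 3 by (simp add: kf_t_def)
    ultimately show ?thesis
      using kf_point_translate [OF step.hyps(1), of m]
        kf_point_translate [OF step.hyps(1), of "Suc m"] 3 by simp
  qed
qed

theorem theorem3p1p6:
  fixes n :: nat
  assumes "1 \<le> n"
  shows "kf_point n = (kf_T ^^ (n - 1)) 0"
  using assms
proof (induction n rule: dec_induct)
  case base
  then show ?case using kf_point_one by simp
next
  case (step n)
  obtain i where i: "n = Suc i"
    using step.hyps(1) by (cases n) auto
  \<comment> \<open>The list of index \<open>Suc n\<close> has at least \<open>Suc n\<close>
    entries, so it contains both points.\<close>
  have "kf_T (kf_point n) = kf_point (Suc n)"
    using kf_T_kf_point [of "Suc n" i] le_kf_t [of "Suc n"] i by simp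
  then show ?case using step.IH i by simp
qed

end
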